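(* Let $\mathcal{X}=\{1,\dots,m\}$, let $q$ be a positive measure on $\mathcal{X}$ with full support, and let $A\in\mathbb{R}^{d\times m}$ be a matrix whose row span contains $(1,\dots,1)$. Let $A'$ be a matrix whose rows consist of one positive cocircuit vector of $A$ for every positive cocircuit of $A$. Then $\mathcal{E}_{q,A}=\mathcal{E}_{q,A'}$, and the image $\hat{\mathcal{E}}_{q,A'}$ of the monomial parametrization of $\mathcal{E}_{q,A'}$ equals $\overline{\mathcal{E}_{q,A'}}$.
   Context: $\mathcal{P}(\mathcal{X})$ is the open simplex of probability measures with full support on $\mathcal{X}$, viewed as a subset of $\mathbb{R}^{\mathcal{X}}$; closures are taken in the standard topology of $\mathbb{R}^{\mathcal{X}}$. For a matrix $B\in\mathbb{R}^{k\times m}$ with columns $b_x\in\mathbb{R}^k$, $x\in\mathcal{X}$, the exponential family associated with $q$ and $B$ is $$\mathcal{E}_{q,B}=\Big\{p_\theta\in\mathcal{P}(\mathcal{X}) : p_\theta(x)=\frac{q(x)}{Z_\theta}\exp(\theta^{T}b_x),\ \theta\in\mathbb{R}^k\Big\},\qquad Z_\theta=\sum_{x\in\mathcal{X}}q(x)\exp(\theta^{T}b_x).$$ If $B=(b_{j,x})$ has only non-negative entries, the monomial parametrization is $$\hat p_\xi(x)=\frac{q(x)}{Z_\xi}\prod_{j=1}^{k}\xi_j^{b_{j,x}},\qquad Z_\xi=\sum_{x\in\mathcal{X}}q(x)\prod_{j=1}^{k}\xi_j^{b_{j,x}},$$ defined for $\xi\in\mathbb{R}^k$ with $\xi_j\ge0$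 for all $j$ and $Z_\xi>0$ (convention $0^0=1$). Its image is $\hat{\mathcal{E}}_{q,B}=\{\hat p_\xi:\xi_j\ge 0\text{ for all }j,\ Z_\xi>0\}$. A cocircuit vector of $A$ is a nonzero vector in the row span of $A$ with inclusion-minimal support (among nonzero vectors of the row span), where $\operatorname{supp}(v)=\{x:v(x)\ne0\}$. A cocircuit vector is positive if all of its components are non-negative. A positive cocircuit is the support set of a positive cocircuit vector. *)

theory Defs
  imports "HOL-Analysis.Analysis"
begin

text \<open>
  The finite set of outcomes is the index type \<open>'x\<close>, and a matrix with \<open>k\<close> rows whose columns are
  indexed by outcomes is \<open>B :: real ^ 'x ^ 'k\<close>; thus \<open>B $ j $ x\<close> is the entry in row \<open>j\<close> and
  column \<open>x\<close>. The row span of \<open>B\<close> is \<open>span (rows B)\<close>.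
\<close>

definition prob_simplex :: "(real ^ 'x::finite) set" where
  "prob_simplex = {p. (\<forall>x. 0 < p $ x) \<and> (\<Sum>x\<in>UNIV. p $ x) = 1}"

definition exp_partition :: "real ^ 'x::finite \<Rightarrow> real ^ 'x ^ 'k::finite \<Rightarrow> real ^ 'k \<Rightarrow> real" where
  "exp_partition q B \<theta> = (\<Sum>x\<in>UNIV. q $ x * exp (\<theta> \<bullet> column x B))"

definition exp_family :: "real ^ 'x::finite \<Rightarrow> real ^ 'x ^ 'k::finite \<Rightarrow> (real ^ 'x) set" where
  "exp_family q B = {p \<in> prob_simplex.
     \<exists>\<theta>. \<forall>x. p $ x = q $ x / exp_partition q B \<theta> * exp (\<theta> \<bullet> column x B)}"

text \<open>
  Real powers of non-negative bases with the convention \<open>0\<^sup>0 = 1\<close>; the library has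
  \<open>0 powr 0 = 0\<close>.
\<close>

definition rpow :: "real \<Rightarrow> real \<Rightarrow> real" where
  "rpow t b = (if b = 0 then 1 else t powr b)"

definition monomial :: "real ^ 'x::finite ^ 'k::finite \<Rightarrow> real ^ 'k \<Rightarrow> 'x \<Rightarrow> real" where
  "monomial B \<xi> x = (\<Prod>j\<in>UNIV. rpow (\<xi> $ j) (B $ j $ x))"

definition monomial_partition :: "real ^ 'x::finite \<Rightarrow> real ^ 'x ^ 'k::finite \<Rightarrow> real ^ 'k \<Rightarrow> real" where
  "monomial_partition q B \<xi> = (\<Sum>x\<in>UNIV. q $ x * monomial B \<xi> x)"

definition monomial_param ::
    "real ^ 'x::finite \<Rightarrow> real ^ 'x ^ 'k::finite \<Rightarrow> real ^ 'k \<Rightarrow> real ^ 'x" where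
  "monomial_param q B \<xi> = (\<chi> x. q $ x / monomial_partition q B \<xi> * monomial B \<xi> x)"

text \<open>The monomial parametrization is meant for matrices \<open>B\<close> with non-negative entries only.\<close>

definition monomial_image :: "real ^ 'x::finite \<Rightarrow> real ^ 'x ^ 'k::finite \<Rightarrow> (real ^ 'x) set" where
  "monomial_image q B =
     monomial_param q B ` {\<xi>. (\<forall>j. 0 \<le> \<xi> $ j) \<and> 0 < monomial_partition q B \<xi>}"

definition supp :: "real ^ 'x::finite \<Rightarrow> 'x set" where
  "supp v = {x. v $ x \<noteq> 0}"

definition cocircuit_vector :: "real ^ 'x::finite ^ 'd::finite \<Rightarrow> real ^ 'x \<Rightarrow> bool" where
  "cocircuit_vector A v \<longleftrightarrow>
     v \<in> span (rows A) \<and> v \<noteq> 0 \<and> (\<forall>w \<in> span (rows A). w \<noteq> 0 \<longrightarrow> \<not> supp w \<subset> supp v)"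

definition positive_cocircuit_vector :: "real ^ 'x::finite ^ 'd::finite \<Rightarrow> real ^ 'x \<Rightarrow> bool" where
  "positive_cocircuit_vector A v \<longleftrightarrow> cocircuit_vector A v \<and> (\<forall>x. 0 \<le> v $ x)"

definition positive_cocircuits :: "real ^ 'x::finite ^ 'd::finite \<Rightarrow> 'x set set" where
  "positive_cocircuits A = supp ` {v. positive_cocircuit_vector A v}"

text \<open>
  The rows of \<open>A'\<close> consist of exactly one positive cocircuit vector of \<open>A\<close> for every positive
  cocircuit of \<open>A\<close>. The type \<open>'k\<close> of row indices thus has as many elements as there are positive
  cocircuits, and requiring it to be non-empty is harmless: if the row span of \<open>A\<close> contains the
  all-ones vector, then \<open>A\<close> has a positive cocircuit.
\<close>

definition positive_cocircuit_matrix ::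
    "real ^ 'x::finite ^ 'd::finite \<Rightarrow> real ^ 'x ^ 'k::finite \<Rightarrow> bool" where
  "positive_cocircuit_matrix A A' \<longleftrightarrow>
     (\<forall>j. positive_cocircuit_vector A (row j A')) \<and>
     bij_betw (\<lambda>j. supp (row j A')) UNIV (positive_cocircuits A)"

end

theory Submission
  imports Defs
begin

text \<open>
  Write \<open>L\<close> for the row span of \<open>A\<close>. A distribution \<open>p\<close> lies in \<open>exp_family q A\<close> iff
  \<open>p = q exp(v)\<close> pointwise for some \<open>v \<in> L\<close>, since the normalizing constant is absorbed by a
  multiple of the all-ones vector (\<open>exp_family_iff_span_rows\<close>); so the family depends on \<open>L\<close> only.

  The combinatorial core is that the rows of \<open>A'\<close> generate the cone of non-negative vectors of \<open>L\<close> (\<open>nonneg_in_span_rows_imp_cone\<close>). As \<open>L\<close> contains the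
  all-ones vector, adding a large multiple of it makes any vector of \<open>L\<close> non-negative, so these
  rows also span \<open>L\<close>. Hence \<open>A\<close> and \<open>A'\<close> have the same row span, and the
  two exponential families agree.

  A parameter vector with positive entries is a vector of exponentials, so its monomial
  distribution lies in the family; one with some zero entries is a limit of such vectors, and the
  monomials are continuous because \<open>A'\<close> is non-negative
  (\<open>monomial_image_subset_closure_exp_family\<close>).

  Conversely, let \<open>p\<close> be a limit of \<open>q exp(v\<^sub>n)\<close> with \<open>v\<^sub>n \<in> L\<close>, and let \<open>F\<close> be the support of
  \<open>p\<close>. On \<open>F\<close> the \<open>v\<^sub>n\<close> converge, off \<open>F\<close> they tend to \<open>-\<infinity>\<close>. The restrictions to \<open>F\<close> of vectors
  in \<open>L\<close> form a closed subspace which lifts linearly, hence continuously, back to \<open>L\<close>. The lift of the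
  limit gives \<open>v \<in> L\<close> with \<open>p = q exp(v)\<close> on \<open>F\<close>. The lift of \<open>v\<^sub>n\<close> restricted to \<open>F\<close> stays bounded, so
  for large \<open>n\<close> subtracting \<open>v\<^sub>n\<close> from it gives some \<open>w \<in> L\<close> that vanishes on \<open>F\<close> and is positive elsewhere
  (\<open>limit_of_exp_family\<close>). Now \<open>v\<close> is a combination of the rows of \<open>A'\<close>, with coefficients
  \<open>\<theta>\<close>, and \<open>w\<close> is a non-negative one. Put \<open>\<xi>\<^sub>j = exp(\<theta>\<^sub>j)\<close> for the rows that do not vanish on \<open>F\<close> and
  \<open>\<xi>\<^sub>j = 0\<close> for the others. The former reproduce \<open>v\<close> on \<open>F\<close>; the latter are enough to
  make the monomial vanish off \<open>F\<close>, because all rows entering \<open>w\<close> vanish on \<open>F\<close>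
  (\<open>face_distribution_in_monomial_image\<close>).
\<close>

section \<open>Exponential families and the row span\<close>

lemma row_in_span: "row i B \<in> span (rows B)"
  by (rule span_base) (auto simp: rows_def)

lemma in_span_rows_iff:
  fixes B :: "real ^ 'x::finite ^ 'k::finite"
  shows "v \<in> span (rows B) \<longleftrightarrow> (\<exists>\<theta>. \<forall>x. v $ x = \<theta> \<bullet> column x B)"
proof -
  have eq: "(\<Sum>j\<in>UNIV. c $ j *\<^sub>R row j B) $ x = c \<bullet> column x B" for c x
    by (simp add: inner_vec_def row_def column_def)
  have "span (rows B) = range (\<lambda>c::real^'k. \<Sum>j\<in>UNIV. c $ j *\<^sub>R row j B)" (is "?S = ?R")
  proof
    have "subspace ?R"
    proof (rule subspaceI)
      show "0 \<in> ?R" by (rule image_eqI[where x = 0]) auto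
    next
      fix a b assume "a \<in> ?R" "b \<in> ?R"
      then obtain c d :: "real^'k" where "a = (\<Sum>j\<in>UNIV. c $ j *\<^sub>R row j B)" "b = (\<Sum>j\<in>UNIV. d $ j *\<^sub>R row j B)"
        by blast
      then show "a + b \<in> ?R"
        by (intro image_eqI[where x = "c + d"]) (auto simp: sum.distrib scaleR_left_distrib)
    next
      fix r a assume "a \<in> ?R"
      then obtain c :: "real^'k" where "a = (\<Sum>j\<in>UNIV. c $ j *\<^sub>R row j B)"
        by blast
      then show "r *\<^sub>R a \<in> ?R"
        by (intro image_eqI[where x = "r *\<^sub>R c"]) (auto simp: scaleR_sum_right)
    qed
    moreover have "rows B \<subseteq> ?R"
    proof
      fix r assume "r \<in> rows B"
      then obtain i where "r = row i B" by (auto simp: rows_def)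
      then show "r \<in> ?R"
        by (intro image_eqI[where x = "axis i 1"])
           (simp_all add: axis_def if_distrib[of "\<lambda>c. c *\<^sub>R _"] cong: if_cong)
    qed
    ultimately show "?S \<subseteq> ?R" by (rule span_minimal[rotated])
  next
    show "?R \<subseteq> ?S"
      by (auto intro!: span_sum span_scale row_in_span)
  qed
  then have "v \<in> span (rows B) \<longleftrightarrow> (\<exists>c::real^'k. v = (\<Sum>j\<in>UNIV. c $ j *\<^sub>R row j B))"
    by blast
  then show ?thesis
    by (simp only: vec_eq_iff eq)
qed

lemma exp_partition_pos:
  assumes "\<forall>x. 0 < q $ x"
  shows "0 < exp_partition q B \<theta>"
  unfolding exp_partition_def using assms by (intro sum_pos) auto

lemma exp_family_iff_span_rows:
  fixes q :: "real ^ 'x::finite" and B :: "real ^ 'x ^ 'k::finite"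
  assumes q_pos: "\<forall>x. 0 < q $ x" and ones: "(\<chi> x. 1) \<in> span (rows B)"
  shows "p \<in> exp_family q B \<longleftrightarrow>
    p \<in> prob_simplex \<and> (\<exists>v\<in>span (rows B). \<forall>x. p $ x = q $ x * exp (v $ x))"
proof (intro iffI conjI; (elim conjE)?)
  assume p: "p \<in> exp_family q B"
  then show "p \<in> prob_simplex" by (simp add: exp_family_def)
  obtain \<theta> where \<theta>: "p $ x = q $ x / exp_partition q B \<theta> * exp (\<theta> \<bullet> column x B)" for x
    using p by (auto simp: exp_family_def)
  define v where "v = (\<chi> x. \<theta> \<bullet> column x B) - ln (exp_partition q B \<theta>) *\<^sub>R (\<chi> x. 1)"
  have "(\<chi> x. \<theta> \<bullet> column x B) \<in> span (rows B)"
    by (auto simp: in_span_rows_iff)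
  then have "v \<in> span (rows B)"
    unfolding v_def using ones by (intro span_diff span_scale)
  moreover have "p $ x = q $ x * exp (v $ x)" for x
    using exp_partition_pos[OF q_pos, of B \<theta>] by (simp add: \<theta> v_def exp_diff)
  ultimately show "\<exists>v\<in>span (rows B). \<forall>x. p $ x = q $ x * exp (v $ x)" by blast
next
  assume p: "p \<in> prob_simplex" and "\<exists>v\<in>span (rows B). \<forall>x. p $ x = q $ x * exp (v $ x)"
  then obtain v where v: "v \<in> span (rows B)" "\<And>x. p $ x = q $ x * exp (v $ x)" by blast
  then obtain \<theta> where "\<And>x. v $ x = \<theta> \<bullet> column x B"
    by (auto simp: in_span_rows_iff)
  then have \<theta>: "p $ x = q $ x * exp (\<theta> \<bullet> column x B)" for x
    by (simp add: v(2))
  then have "exp_partition q B \<theta> = 1"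
    using p by (simp add: exp_partition_def prob_simplex_def)
  then show "p \<in> exp_family q B"
    using p \<theta> by (auto simp: exp_family_def intro!: exI[of _ \<theta>])
qed

section \<open>Positive cocircuit vectors generate the non-negative cone\<close>

text \<open>
  Both the existence of positive cocircuits below a non-negative vector and the cone decomposition
  rest on this elimination step: subtract the largest multiple of \<open>u\<close> that keeps \<open>w\<close>
  non-negative; a coordinate attaining the bound drops out of the support.
\<close>
lemma nonneg_eliminate:
  fixes u w :: "real ^ 'x::finite"
  assumes w: "\<forall>x. 0 \<le> w $ x" and sub: "supp u \<subseteq> supp w" and pos: "0 < u $ y"
  obtains t where "0 \<le> t" "\<forall>x. 0 \<le> (w - t *\<^sub>R u) $ x" "supp (w - t *\<^sub>R u) \<subset> supp w"
proof -
  let ?P = "{x. 0 < u $ x}"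
  define t where "t = Min ((\<lambda>x. w $ x / u $ x) ` ?P)"
  have "?P \<noteq> {}" using pos by blast
  then have "t \<in> (\<lambda>x. w $ x / u $ x) ` ?P"
    unfolding t_def by (intro Min_in) auto
  then obtain z where z: "0 < u $ z" "t = w $ z / u $ z" by blast
  have t0: "0 \<le> t" using z w by simp
  have le: "t \<le> w $ x / u $ x" if "0 < u $ x" for x
    unfolding t_def using that by (intro Min_le) auto
  have "0 \<le> (w - t *\<^sub>R u) $ x" for x
  proof (cases "0 < u $ x")
    case True
    then show ?thesis using le[OF True] by (simp add: field_simps)
  next
    case False
    then have "t * u $ x \<le> 0" using t0 by (simp add: mult_nonneg_nonpos)
    then show ?thesis using w[rule_format, of x] by simp
  qed
  moreover have "supp (w - t *\<^sub>R u) \<subset> supp w"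
  proof
    show "supp (w - t *\<^sub>R u) \<subseteq> supp w" using sub by (auto simp: supp_def)
    have "z \<in> supp w" "z \<notin> supp (w - t *\<^sub>R u)" using z sub by (auto simp: supp_def subset_iff)
    then show "supp (w - t *\<^sub>R u) \<noteq> supp w" by blast
  qed
  ultimately show thesis using that t0 by blast
qed

lemma ex_positive_cocircuit_vector_below:
  fixes A :: "real ^ 'x::finite ^ 'd::finite"
  assumes "v \<in> span (rows A)" "\<forall>x. 0 \<le> v $ x" "v \<noteq> 0"
  shows "\<exists>w. positive_cocircuit_vector A w \<and> supp w \<subseteq> supp v"
  using assms
proof (induction "card (supp v)" arbitrary: v rule: less_induct)
  case less
  show ?case
  proof (cases "cocircuit_vector A v")
    case True
    then show ?thesis using less.prems by (auto simp: positive_cocircuit_vector_def)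
  next
    case False
    then obtain u0 where u0: "u0 \<in> span (rows A)" "u0 \<noteq> 0" "supp u0 \<subset> supp v"
      using less.prems by (auto simp: cocircuit_vector_def)
    obtain y where "u0 $ y \<noteq> 0" using u0 by (auto simp: vec_eq_iff)
    (* elimination needs a positive entry; the span and the support ignore the sign *)
    define u where "u = (if 0 < u0 $ y then u0 else - u0)"
    have u: "u \<in> span (rows A)" "supp u \<subset> supp v" "0 < u $ y"
      using u0 \<open>u0 $ y \<noteq> 0\<close> by (auto simp: u_def supp_def span_neg)
    obtain t where t: "\<forall>x. 0 \<le> (v - t *\<^sub>R u) $ x" "supp (v - t *\<^sub>R u) \<subset> supp v"
      using nonneg_eliminate[OF less.prems(2) psubset_imp_subset[OF u(2)] u(3)] by metis
    have "v - t *\<^sub>R u \<in> span (rows A)"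
      using u less.prems by (intro span_diff span_scale)
    moreover have "v - t *\<^sub>R u \<noteq> 0"
    proof -
      obtain z where "z \<in> supp v" "z \<notin> supp u" using u by blast
      then have "(v - t *\<^sub>R u) $ z \<noteq> 0" by (simp add: supp_def)
      then show ?thesis by (metis zero_index)
    qed
    moreover have "card (supp (v - t *\<^sub>R u)) < card (supp v)"
      using t by (intro psubset_card_mono) auto
    ultimately show ?thesis
      using less.hyps[of "v - t *\<^sub>R u"] t by blast
  qed
qed

text \<open>
  As long as \<open>v\<close> is not zero, a row of \<open>A'\<close> supported inside \<open>v\<close> can be subtracted to shrink the
  support. The rows are one representative per positive cocircuit, which suffices because only
  their supports matter for this step.
\<close>
lemma nonneg_in_span_rows_imp_cone:
  fixes A :: "real ^ 'x::finite ^ 'd::finite" and A' :: "real ^ 'x ^ 'k::finite"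
  assumes A': "positive_cocircuit_matrix A A'"
    and v: "v \<in> span (rows A)" "\<forall>x. 0 \<le> v $ x"
  shows "\<exists>c. (\<forall>j. 0 \<le> c j) \<and> v = (\<Sum>j\<in>UNIV. c j *\<^sub>R row j A')"
  using v
proof (induction "card (supp v)" arbitrary: v rule: less_induct)
  case less
  show ?case
  proof (cases "v = 0")
    case True
    then show ?thesis by (intro exI[of _ "\<lambda>_. 0"]) auto
  next
    case False
    obtain w where w: "positive_cocircuit_vector A w" "supp w \<subseteq> supp v"
      using ex_positive_cocircuit_vector_below[of v A] less.prems False by blast
    then have "supp w \<in> range (\<lambda>j. supp (row j A'))"
      using A' by (auto simp: positive_cocircuit_matrix_def positive_cocircuits_def bij_betw_def)
    then obtain i where i: "supp (row i A') \<subseteq> supp v" using w by auto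
    have row: "row i A' \<in> span (rows A)" "row i A' \<noteq> 0" "\<forall>x. 0 \<le> row i A' $ x"
      using A' by (auto simp: positive_cocircuit_matrix_def positive_cocircuit_vector_def
          cocircuit_vector_def)
    obtain y where "0 < row i A' $ y"
      using row by (metis less_eq_real_def vec_eq_iff zero_index)
    then obtain t where t: "0 \<le> t" "\<forall>x. 0 \<le> (v - t *\<^sub>R row i A') $ x"
        "supp (v - t *\<^sub>R row i A') \<subset> supp v"
      using nonneg_eliminate[OF less.prems(2) i] by metis
    have "card (supp (v - t *\<^sub>R row i A')) < card (supp v)"
      using t by (intro psubset_card_mono) auto
    moreover have "v - t *\<^sub>R row i A' \<in> span (rows A)"
      using row less.prems by (intro span_diff span_scale)
    ultimately obtain c where c: "\<forall>j. 0 \<le> c j"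
        "v - t *\<^sub>R row i A' = (\<Sum>j\<in>UNIV. c j *\<^sub>R row j A')"
      using less.hyps t by blast
    have "v = (\<Sum>j\<in>UNIV. c j *\<^sub>R row j A') + (\<Sum>j\<in>UNIV. if j = i then t *\<^sub>R row j A' else 0)"
      by (simp add: c(2)[symmetric])
    also have "\<dots> = (\<Sum>j\<in>UNIV. (c j + (if j = i then t else 0)) *\<^sub>R row j A')"
      by (simp only: sum.distrib[symmetric]) (auto simp: scaleR_left_distrib intro!: sum.cong)
    finally show ?thesis
      using c(1) t(1) by (intro exI[of _ "\<lambda>j. c j + (if j = i then t else 0)"]) auto
  qed
qed

lemma span_rows_positive_cocircuit_matrix:
  fixes A :: "real ^ 'x::finite ^ 'd::finite" and A' :: "real ^ 'x ^ 'k::finite"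
  assumes A': "positive_cocircuit_matrix A A'" and ones: "(\<chi> x. 1) \<in> span (rows A)"
  shows "span (rows A') = span (rows A)"
proof
  have "rows A' \<subseteq> span (rows A)"
    using A' by (auto simp: rows_def positive_cocircuit_matrix_def positive_cocircuit_vector_def
        cocircuit_vector_def)
  then show "span (rows A') \<subseteq> span (rows A)" by (simp add: span_minimal)
next
  have nonneg: "v \<in> span (rows A')" if v: "v \<in> span (rows A)" "\<forall>x. 0 \<le> v $ x" for v
  proof -
    obtain c where "v = (\<Sum>j\<in>UNIV. c j *\<^sub>R row j A')"
      using nonneg_in_span_rows_imp_cone[OF A' v] by blast
    then show ?thesis by (simp add: span_sum span_scale row_in_span)
  qed
  show "span (rows A) \<subseteq> span (rows A')"
  proof
    fix v assume v: "v \<in> span (rows A)"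
    let ?one = "(\<chi> x. 1) :: real ^ 'x"
    have "v + norm v *\<^sub>R ?one \<in> span (rows A')"
    proof (rule nonneg)
      show "v + norm v *\<^sub>R ?one \<in> span (rows A)"
        using v ones by (intro span_add span_scale)
      show "\<forall>x. 0 \<le> (v + norm v *\<^sub>R ?one) $ x"
      proof
        fix x
        show "0 \<le> (v + norm v *\<^sub>R ?one) $ x"
          using component_le_norm_cart[of v x] by simp
      qed
    qed
    moreover have "norm v *\<^sub>R ?one \<in> span (rows A')"
      using ones by (intro span_scale nonneg) auto
    ultimately have "v + norm v *\<^sub>R ?one - norm v *\<^sub>R ?one \<in> span (rows A')"
      by (rule span_diff)
    then show "v \<in> span (rows A')" by simp
  qed
qed

section \<open>Monomial distributions are limits of the family\<close>

lemma monomial_exp: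
  fixes B :: "real ^ 'x::finite ^ 'k::finite"
  assumes "\<And>j. B $ j $ x \<noteq> 0 \<Longrightarrow> \<xi> $ j = exp (\<theta> $ j)"
  shows "monomial B \<xi> x = exp (\<theta> \<bullet> column x B)"
proof -
  have "monomial B \<xi> x = (\<Prod>j\<in>UNIV. exp (\<theta> $ j * B $ j $ x))"
    unfolding monomial_def
    by (intro prod.cong) (auto simp: rpow_def powr_def assms)
  then show ?thesis by (simp add: exp_sum inner_vec_def column_def)
qed

lemma monomial_param_pos_in_exp_family:
  fixes q :: "real ^ 'x::finite" and B :: "real ^ 'x ^ 'k::finite"
  assumes q_pos: "\<forall>x. 0 < q $ x" and \<xi>: "\<forall>j. 0 < \<xi> $ j"
  shows "monomial_param q B \<xi> \<in> exp_family q B"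
proof -
  define \<theta> where "\<theta> = (\<chi> j. ln (\<xi> $ j))"
  have m: "monomial B \<xi> x = exp (\<theta> \<bullet> column x B)" for x
    using \<xi> by (intro monomial_exp) (simp add: \<theta>_def)
  have Z: "monomial_partition q B \<xi> = exp_partition q B \<theta>"
    by (simp add: monomial_partition_def exp_partition_def m)
  have "0 < exp_partition q B \<theta>" by (rule exp_partition_pos[OF q_pos])
  then have "monomial_param q B \<xi> \<in> prob_simplex"
    using q_pos by (auto simp: prob_simplex_def monomial_param_def Z m
        exp_partition_def sum_divide_distrib[symmetric])
  then show ?thesis
    by (auto simp: exp_family_def monomial_param_def Z m)
qed

lemma tendsto_rpow:
  assumes f: "(f \<longlongrightarrow> a) F" and nonneg: "\<forall>\<^sub>F n in F. 0 \<le> f n" and b: "0 \<le> b"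
  shows "((\<lambda>n. rpow (f n) b) \<longlongrightarrow> rpow a b) F"
  using assms unfolding rpow_def by (auto intro!: tendsto_powr')

lemma monomial_image_subset_closure_exp_family:
  fixes q :: "real ^ 'x::finite" and B :: "real ^ 'x ^ 'k::finite"
  assumes q_pos: "\<forall>x. 0 < q $ x" and B: "\<forall>j x. 0 \<le> B $ j $ x"
  shows "monomial_image q B \<subseteq> closure (exp_family q B)"
proof
  fix p assume "p \<in> monomial_image q B"
  then obtain \<xi> where \<xi>: "\<forall>j. 0 \<le> \<xi> $ j" "0 < monomial_partition q B \<xi>" "p = monomial_param q B \<xi>"
    by (auto simp: monomial_image_def)
  define \<xi>' where "\<xi>' n = (\<chi> j. \<xi> $ j + 1 / real (Suc n))" for n
  have pos: "\<forall>j. 0 < \<xi>' n $ j" for n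
    using \<xi>(1) by (auto simp: \<xi>'_def intro!: add_nonneg_pos)
  have "(\<lambda>n. \<xi>' n $ j) \<longlonglongrightarrow> \<xi> $ j" for j
    using tendsto_add[OF tendsto_const LIMSEQ_inverse_real_of_nat, of "\<xi> $ j"]
    by (simp add: \<xi>'_def inverse_eq_divide)
  then have rp: "(\<lambda>n. rpow (\<xi>' n $ j) (B $ j $ x)) \<longlonglongrightarrow> rpow (\<xi> $ j) (B $ j $ x)" for j x
    using B pos by (intro tendsto_rpow) (auto simp: less_imp_le)
  have m: "(\<lambda>n. monomial B (\<xi>' n) x) \<longlonglongrightarrow> monomial B \<xi> x" for x
    unfolding monomial_def by (intro tendsto_prod rp)
  then have Z: "(\<lambda>n. monomial_partition q B (\<xi>' n)) \<longlonglongrightarrow> monomial_partition q B \<xi>"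
    unfolding monomial_partition_def by (intro tendsto_sum tendsto_mult tendsto_const)
  have "(\<lambda>n. monomial_param q B (\<xi>' n)) \<longlonglongrightarrow> p"
    unfolding \<xi>(3) using \<xi>(2)
    by (intro vec_tendstoI) (auto simp: monomial_param_def intro!: tendsto_intros m Z)
  then show "p \<in> closure (exp_family q B)"
    unfolding closure_sequential using monomial_param_pos_in_exp_family[OF q_pos pos]
    by (intro exI[of _ "\<lambda>n. monomial_param q B (\<xi>' n)"]) auto
qed

section \<open>Limits of the family are monomial distributions\<close>

text \<open>
  The shape of a limit point \<open>p\<close>: on its support it looks like a member of the family, and its
  zeros are the support of a non-negative vector of the row span. The linear right inverse
  \<open>g\<close> of the restriction to the support produces both vectors; linearity turns convergence of the
  restrictions into convergence of their lifts.
\<close>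
lemma limit_of_exp_family:
  fixes q :: "real ^ 'x::finite" and B :: "real ^ 'x ^ 'k::finite"
  assumes q_pos: "\<forall>x. 0 < q $ x" and ones: "(\<chi> x. 1) \<in> span (rows B)"
    and p: "p \<in> closure (exp_family q B)"
  obtains v w where "v \<in> span (rows B)" "w \<in> span (rows B)"
    "\<And>x. p $ x \<noteq> 0 \<Longrightarrow> p $ x = q $ x * exp (v $ x) \<and> w $ x = 0"
    "\<And>x. p $ x = 0 \<Longrightarrow> 0 < w $ x"
    "(\<Sum>x\<in>UNIV. p $ x) = 1"
proof -
  let ?L = "span (rows B)"
  obtain P where P: "\<And>n. P n \<in> exp_family q B" and lim: "P \<longlonglongrightarrow> p"
    using p unfolding closure_sequential by blast
  have limx: "(\<lambda>n. P n $ x) \<longlonglongrightarrow> p $ x" for x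
    using lim by (rule tendsto_vec_nth)
  have "\<forall>n. \<exists>v\<in>?L. \<forall>x. P n $ x = q $ x * exp (v $ x)"
    using P by (simp add: exp_family_iff_span_rows[OF q_pos ones])
  then obtain V where V: "\<And>n. V n \<in> ?L" and PV: "\<And>n x. P n $ x = q $ x * exp (V n $ x)"
    by metis
  have "(\<lambda>n. \<Sum>x\<in>UNIV. P n $ x) \<longlonglongrightarrow> (\<Sum>x\<in>UNIV. p $ x)"
    by (intro tendsto_sum limx)
  moreover have "(\<Sum>x\<in>UNIV. P n $ x) = 1" for n
    using P[of n] by (simp add: exp_family_def prob_simplex_def)
  ultimately have sum1: "(\<Sum>x\<in>UNIV. p $ x) = 1"
    by (simp add: LIMSEQ_const_iff)
  have p_nonneg: "0 \<le> p $ x" for x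
    using limx[of x] q_pos[rule_format, of x]
    by (intro tendsto_lowerbound[of "\<lambda>n. P n $ x"]) (auto simp: PV less_imp_le)

  define R :: "real ^ 'x \<Rightarrow> real ^ 'x" where "R v = (\<chi> x. if p $ x \<noteq> 0 then v $ x else 0)" for v
  have R_lin: "linear R"
    by (rule linearI) (auto simp: R_def vec_eq_iff)
  obtain g where g: "range g \<subseteq> ?L" "linear g" and Rg: "\<And>v. v \<in> R ` ?L \<Longrightarrow> R (g v) = v"
    using linear_exists_right_inverse_on[of R ?L] R_lin by auto
  define l where "l = (\<chi> x. if p $ x \<noteq> 0 then ln (p $ x / q $ x) else 0)"
  have V_eq: "V n $ x = ln (P n $ x / q $ x)" for n x
    using q_pos[rule_format, of x] by (simp add: PV)
  have "(\<lambda>n. V n $ x) \<longlonglongrightarrow> ln (p $ x / q $ x)" if "p $ x \<noteq> 0" for x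
    unfolding V_eq using that q_pos[rule_format, of x]
    by (intro tendsto_intros limx) auto
  then have RV: "(\<lambda>n. R (V n)) \<longlonglongrightarrow> l"
    by (intro vec_tendstoI) (auto simp: R_def l_def)
  have g_cont: "(\<lambda>n. g (R (V n))) \<longlonglongrightarrow> g l"
    by (rule bounded_linear.tendsto[OF linear_conv_bounded_linear[THEN iffD1, OF g(2)] RV])
  have "closed (R ` ?L)"
    by (intro closed_subspace linear_subspace_image R_lin subspace_span)
  then have "l \<in> R ` ?L"
    using RV V by (meson closed_sequentially imageI)
  then have Rgl: "R (g l) = l" by (rule Rg)

  have far: "\<forall>\<^sub>F n in sequentially. V n $ x < g (R (V n)) $ x" if x: "p $ x = 0" for x
  proof -
    (* any constant that the convergent lifts eventually exceed at x would do *)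
    let ?c = "g l $ x - 1"
    have "\<forall>\<^sub>F n in sequentially. P n $ x < q $ x * exp ?c"
      using limx[of x] x q_pos[rule_format, of x] by (intro order_tendstoD) auto
    moreover have "\<forall>\<^sub>F n in sequentially. ?c < g (R (V n)) $ x"
      using tendsto_vec_nth[OF g_cont, of x] by (intro order_tendstoD) auto
    ultimately show ?thesis
    proof eventually_elim
      case (elim n)
      then have "exp (V n $ x) < exp ?c"
        using q_pos[rule_format, of x] by (simp add: PV)
      then show ?case using elim by simp
    qed
  qed
  have "\<forall>\<^sub>F n in sequentially. \<forall>x\<in>{x. p $ x = 0}. V n $ x < g (R (V n)) $ x"
    by (rule eventually_ball_finite) (auto intro: far)
  then obtain n where n: "\<And>x. p $ x = 0 \<Longrightarrow> V n $ x < g (R (V n)) $ x"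
    by (auto simp: eventually_sequentially)
  show thesis
  proof (rule that[of "g l" "g (R (V n)) - V n"])
    show "g l \<in> ?L" "g (R (V n)) - V n \<in> ?L"
      using g V by (auto intro: span_diff)
    show "(\<Sum>x\<in>UNIV. p $ x) = 1" by (rule sum1)
    show "0 < (g (R (V n)) - V n) $ x" if "p $ x = 0" for x
      using n[OF that] by simp
    show "p $ x = q $ x * exp (g l $ x) \<and> (g (R (V n)) - V n) $ x = 0" if x: "p $ x \<noteq> 0" for x
    proof
      have "g l $ x = ln (p $ x / q $ x)"
        using arg_cong[OF Rgl, of "\<lambda>v. v $ x"] x by (simp add: R_def l_def)
      then show "p $ x = q $ x * exp (g l $ x)"
        using x p_nonneg[of x] q_pos[rule_format, of x] by simp
      have "R (g (R (V n))) = R (V n)" using V by (intro Rg) auto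
      from arg_cong[OF this, of "\<lambda>v. v $ x"]
      show "(g (R (V n)) - V n) $ x = 0" using x by (simp add: R_def)
    qed
  qed
qed

text \<open>
  A row with \<open>\<xi>\<^sub>j = 0\<close> must vanish on the support of \<open>p\<close>, and each zero of \<open>p\<close> must be hit by
  such a row. The non-negative combination of rows guarantees the latter: where the sum vanishes, every
  row with positive coefficient vanishes as well.
\<close>
lemma face_distribution_in_monomial_image:
  fixes q :: "real ^ 'x::finite" and B :: "real ^ 'x ^ 'k::finite"
  assumes B: "\<forall>j x. 0 \<le> B $ j $ x" and c: "\<forall>j. 0 \<le> c j"
    and on: "\<And>x. p $ x \<noteq> 0 \<Longrightarrow>
      p $ x = q $ x * exp (\<theta> \<bullet> column x B) \<and> (\<Sum>j\<in>UNIV. c j * B $ j $ x) = 0"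
    and off: "\<And>x. p $ x = 0 \<Longrightarrow> 0 < (\<Sum>j\<in>UNIV. c j * B $ j $ x)"
    and sum1: "(\<Sum>x\<in>UNIV. p $ x) = 1"
  shows "p \<in> monomial_image q B"
proof -
  define \<xi> where "\<xi> = (\<chi> j. if \<forall>x. p $ x \<noteq> 0 \<longrightarrow> B $ j $ x = 0 then 0 else exp (\<theta> $ j))"
  have p_eq: "p $ x = q $ x * monomial B \<xi> x" for x
  proof (cases "p $ x = 0")
    case False
    have "monomial B \<xi> x = exp (\<theta> \<bullet> column x B)"
      using False by (intro monomial_exp) (auto simp: \<xi>_def)
    then show ?thesis using on[OF False] by simp
  next
    case True
    obtain j where "c j * B $ j $ x \<noteq> 0"
      using off[OF True] sum.not_neutral_contains_not_neutral[of "\<lambda>j. c j * B $ j $ x" UNIV]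
      by auto
    then have j: "c j \<noteq> 0" "B $ j $ x \<noteq> 0" by auto
    have "B $ j $ y = 0" if "p $ y \<noteq> 0" for y
    proof -
      have "c j * B $ j $ y = 0"
        using on[OF that] B c by (subst (asm) sum_nonneg_eq_0_iff) auto
      then show ?thesis using j by simp
    qed
    then have "rpow (\<xi> $ j) (B $ j $ x) = 0"
      using j by (simp add: \<xi>_def rpow_def)
    then have "monomial B \<xi> x = 0"
      unfolding monomial_def by (intro prod_zero) auto
    then show ?thesis using True by simp
  qed
  then have "monomial_partition q B \<xi> = 1"
    using sum1 by (simp add: monomial_partition_def)
  moreover from this have "p = monomial_param q B \<xi>"
    by (simp add: vec_eq_iff monomial_param_def p_eq)
  moreover have "\<forall>j. 0 \<le> \<xi> $ j" by (simp add: \<xi>_def)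
  ultimately show ?thesis by (auto simp: monomial_image_def)
qed

theorem theorem27:
  fixes q :: "real ^ 'x::finite"
    and A :: "real ^ 'x ^ 'd::finite"
    and A' :: "real ^ 'x ^ 'k::finite"
  assumes q_pos: "\<forall>x. 0 < q $ x"
    and ones: "(\<chi> x. 1) \<in> span (rows A)"
    and A': "positive_cocircuit_matrix A A'"
  shows "exp_family q A = exp_family q A' \<and>
         monomial_image q A' = closure (exp_family q A')"
proof (intro conjI subset_antisym)
  have span: "span (rows A') = span (rows A)"
    by (rule span_rows_positive_cocircuit_matrix[OF A' ones])
  then have ones': "(\<chi> x. 1) \<in> span (rows A')" using ones by simp
  have "exp_family q A = exp_family q A'"
    using exp_family_iff_span_rows[OF q_pos ones] exp_family_iff_span_rows[OF q_pos ones'] span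
    by blast
  then show "exp_family q A \<subseteq> exp_family q A'" "exp_family q A' \<subseteq> exp_family q A" by simp_all
  have nonneg: "\<forall>j x. 0 \<le> A' $ j $ x"
    using A' by (simp add: positive_cocircuit_matrix_def positive_cocircuit_vector_def row_def)
  then show "monomial_image q A' \<subseteq> closure (exp_family q A')"
    by (rule monomial_image_subset_closure_exp_family[OF q_pos])
  show "closure (exp_family q A') \<subseteq> monomial_image q A'"
  proof
    fix p assume "p \<in> closure (exp_family q A')"
    then obtain v w where vw: "v \<in> span (rows A')" "w \<in> span (rows A')"
      and on: "\<And>x. p $ x \<noteq> 0 \<Longrightarrow> p $ x = q $ x * exp (v $ x) \<and> w $ x = 0"
      and off: "\<And>x. p $ x = 0 \<Longrightarrow> 0 < w $ x"
      and sum1: "(\<Sum>x\<in>UNIV. p $ x) = 1"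
      using limit_of_exp_family[OF q_pos ones'] by blast
    obtain \<theta> where \<theta>: "\<And>x. v $ x = \<theta> \<bullet> column x A'"
      using vw(1) by (auto simp: in_span_rows_iff)
    have "\<forall>x. 0 \<le> w $ x" using on off by (metis less_eq_real_def)
    then obtain c where c: "\<forall>j. 0 \<le> c j" and "w = (\<Sum>j\<in>UNIV. c j *\<^sub>R row j A')"
      using nonneg_in_span_rows_imp_cone[OF A'] vw(2) span by blast
    then have w: "w $ x = (\<Sum>j\<in>UNIV. c j * A' $ j $ x)" for x
      by (simp add: row_def)
    show "p \<in> monomial_image q A'"
      using face_distribution_in_monomial_image[OF nonneg c _ _ sum1] on off
      unfolding \<theta> w by blast
  qed
qed

end
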